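(* Let $p$ be a prime with $p\equiv 15$ or $27\pmod{28}$. For all integers $n,k\geq 0$ with $p\nmid n$, \[ c_{13,1}\left(8p^{2k+1}n+\frac{26p^{2k+2}+9}{7}\right)\equiv 0\pmod 2. \]
   Context: For complex $a,b$ the false theta function is $\Psi(a,b):=\sum_{n=0}^\infty a^{n(n+1)/2}b^{n(n-1)/2}-\sum_{n=-\infty}^{-1}a^{n(n+1)/2}b^{n(n-1)/2}$. For positive integers $r,s$, the integers $c_{r,s}(n)$ ($n\ge 0$) are defined by the power series identity $\sum_{n=0}^\infty c_{r,s}(n)q^n=\dfrac{1}{\Psi(-q^r,q^s)}$ (the denominator is a power series in $q$ with constant term $1$). *)

theory Defs
  imports "HOL-Analysis.Analysis" "HOL-Number_Theory.Cong"
begin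

text \<open>
  The definition is polymorphic so that it covers both the analytic function (complex
  arguments, convergent for \<open>norm (a * b) < 1\<close>) and its formal version, where \<open>a\<close> and \<open>b\<close>
  are formal power series and the sums converge in the topology of power series. The
  exponents \<open>n(n+1)/2\<close> and \<open>n(n-1)/2\<close> are nonnegative integers for every integer \<open>n\<close>, so
  \<open>div\<close> is exact and \<open>nat\<close> loses nothing.
\<close>
definition false_theta :: "'a \<Rightarrow> 'a \<Rightarrow> 'a::{comm_ring_1, t2_space}" where
  "false_theta a b =
     (\<Sum>\<^sub>\<infinity>n\<in>{0::int..}. a ^ nat (n * (n + 1) div 2) * b ^ nat (n * (n - 1) div 2)) -
     (\<Sum>\<^sub>\<infinity>n\<in>{..-1::int}. a ^ nat (n * (n + 1) div 2) * b ^ nat (n * (n - 1) div 2))"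

text \<open>
  The reciprocal is taken in the ring of formal power series with integer coefficients, where
  the series is a unit because its constant term is \<open>1\<close>. (The library's \<open>inverse\<close> on power
  series needs an inverse on the coefficient ring and is not available over the integers.)
\<close>
definition false_theta_recip_coeff :: "nat \<Rightarrow> nat \<Rightarrow> nat \<Rightarrow> int" where
  "false_theta_recip_coeff r s n =
     fps_nth (THE f :: int fps. f * false_theta (- (fps_X ^ r)) (fps_X ^ s) = 1) n"

text \<open>
  The remaining facts show that these definitions are not vacuous: the sums converge
  and the reciprocal exists.
\<close>

lemma triangular_exponents:
  fixes n :: int
  shows "int (nat (n * (n + 1) div 2)) = n * (n + 1) div 2"
    and "int (nat (n * (n - 1) div 2)) = n * (n - 1) div 2"
    and "nat (n * (n + 1) div 2) + nat (n * (n - 1) div 2) = nat (n ^ 2)"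
proof -
  have "0 \<le> n * (n + 1)"
    by (cases "n \<ge> 0") (auto simp: zero_le_mult_iff)
  moreover have "0 \<le> n * (n - 1)"
    by (cases "n \<ge> 1") (auto simp: zero_le_mult_iff)
  ultimately have nonneg: "0 \<le> n * (n + 1) div 2" "0 \<le> n * (n - 1) div 2"
    by simp_all
  then show "int (nat (n * (n + 1) div 2)) = n * (n + 1) div 2"
    and "int (nat (n * (n - 1) div 2)) = n * (n - 1) div 2"
    by simp_all
  have "2 * (n * (n + 1) div 2) = n * (n + 1)" "2 * (n * (n - 1) div 2) = n * (n - 1)"
    by simp_all
  then have "n * (n + 1) div 2 + n * (n - 1) div 2 = n ^ 2"
    unfolding power2_eq_square ring_distribs by linarith
  then show "nat (n * (n + 1) div 2) + nat (n * (n - 1) div 2) = nat (n ^ 2)"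
    using nonneg by (simp flip: nat_add_distrib)
qed

lemma false_theta_term_nth:
  "fps_nth ((- (fps_X ^ r) :: int fps) ^ i * (fps_X ^ s) ^ j) m =
     (if m = r * i + s * j then (- 1) ^ i else 0)"
proof -
  have "(- (fps_X ^ r) :: int fps) ^ i = fps_const ((- 1) ^ i) * fps_X ^ (r * i)"
    by (subst power_minus) (simp add: power_mult flip: fps_const_power fps_const_neg)
  then have "(- (fps_X ^ r) :: int fps) ^ i * (fps_X ^ s) ^ j
      = fps_const ((- 1) ^ i) * fps_X ^ (r * i + s * j)"
    by (simp only: power_add power_mult mult.assoc)
  then show ?thesis
    by (simp only: fps_mult_left_const_nth fps_X_power_nth mult_1_right mult_zero_right
          split: if_split) simp
qed

lemma false_theta_term_finite:
  assumes "r > 0" "s > 0"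
  shows "finite {n \<in> A. fps_nth ((- (fps_X ^ r) :: int fps) ^ nat (n * (n + 1) div 2) *
                          (fps_X ^ s) ^ nat (n * (n - 1) div 2)) m \<noteq> 0}"
proof (rule finite_subset)
  show "{n \<in> A. fps_nth ((- (fps_X ^ r) :: int fps) ^ nat (n * (n + 1) div 2) *
                  (fps_X ^ s) ^ nat (n * (n - 1) div 2)) m \<noteq> 0} \<subseteq> {- int m..int m}"
  proof
    fix n
    let ?i = "nat (n * (n + 1) div 2)" and ?j = "nat (n * (n - 1) div 2)"
    assume "n \<in> {n \<in> A. fps_nth ((- (fps_X ^ r) :: int fps) ^ nat (n * (n + 1) div 2) *
                  (fps_X ^ s) ^ nat (n * (n - 1) div 2)) m \<noteq> 0}"
    then have m: "m = r * ?i + s * ?j"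
      unfolding false_theta_term_nth mem_Collect_eq by presburger
    have "nat (n ^ 2) = ?i + ?j"
      using triangular_exponents(3) by simp
    also have "\<dots> \<le> r * ?i + s * ?j"
      using assms by (intro add_mono) simp_all
    finally have "n ^ 2 \<le> int m"
      unfolding m by linarith
    moreover have "\<bar>n\<bar> \<le> n ^ 2"
      using self_le_power[of "\<bar>n\<bar>" 2] by (cases "n = 0") auto
    ultimately show "n \<in> {- int m..int m}"
      unfolding atLeastAtMost_iff by linarith
  qed
qed simp

lemma false_theta_fps_has_sum:
  assumes "r > 0" "s > 0"
  shows "((\<lambda>n. (- (fps_X ^ r) :: int fps) ^ nat (n * (n + 1) div 2) *
             (fps_X ^ s) ^ nat (n * (n - 1) div 2)) has_sum
          Abs_fps (\<lambda>m. \<Sum>n | n \<in> A \<and> fps_nth ((- (fps_X ^ r) :: int fps) ^ nat (n * (n + 1) div 2) *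
             (fps_X ^ s) ^ nat (n * (n - 1) div 2)) m \<noteq> 0.
             fps_nth ((- (fps_X ^ r) :: int fps) ^ nat (n * (n + 1) div 2) *
             (fps_X ^ s) ^ nat (n * (n - 1) div 2)) m)) A"
  by (rule has_sum_fpsI) (simp_all only: false_theta_term_finite[OF assms] fps_nth_Abs_fps)

lemma false_theta_fps_nth_0:
  assumes "r > 0" "s > 0"
  shows "fps_nth (false_theta (- (fps_X ^ r)) (fps_X ^ s) :: int fps) 0 = 1"
proof -
  have iff: "0 = r * nat (n * (n + 1) div 2) + s * nat (n * (n - 1) div 2) \<longleftrightarrow> n = 0" for n :: int
  proof
    assume "0 = r * nat (n * (n + 1) div 2) + s * nat (n * (n - 1) div 2)"
    then have "nat (n * (n + 1) div 2) + nat (n * (n - 1) div 2) = 0"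
      using assms by auto
    then have "n ^ 2 \<le> 0"
      unfolding triangular_exponents(3) by simp
    then show "n = 0"
      by simp
  qed simp
  have 1: "{n \<in> {0..}. n = (0::int)} = {0}" and 2: "{n \<in> {..-1}. n = (0::int)} = {}"
    by auto
  have *: "fps_nth (\<Sum>\<^sub>\<infinity>n\<in>A. (- (fps_X ^ r) :: int fps) ^ nat (n * (n + 1) div 2) *
             (fps_X ^ s) ^ nat (n * (n - 1) div 2)) 0 = (\<Sum>n | n \<in> A \<and> n = 0. 1)" for A :: "int set"
    unfolding infsumI[OF false_theta_fps_has_sum[OF assms]] fps_nth_Abs_fps
              false_theta_term_nth iff
    by (rule sum.cong) auto
  show ?thesis
    unfolding false_theta_def fps_sub_nth * using 1 2 by simp
qed

lemma false_theta_recip_coeff_mult: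
  assumes "r > 0" "s > 0"
  shows "Abs_fps (false_theta_recip_coeff r s) * false_theta (- (fps_X ^ r)) (fps_X ^ s) = 1"
proof -
  define F :: "int fps" where "F = false_theta (- (fps_X ^ r)) (fps_X ^ s)"
  have inv: "fps_left_inverse F 1 * F = 1"
    by (rule fps_left_inverse) (simp add: F_def false_theta_fps_nth_0[OF assms])
  then have "F \<noteq> 0"
    by auto
  with inv have "\<exists>!f. f * F = 1"
    by (metis mult_right_cancel)
  then have "(THE f. f * F = 1) * F = 1"
    by (rule theI')
  moreover have "Abs_fps (false_theta_recip_coeff r s) = (THE f. f * F = 1)"
    by (simp add: fps_eq_iff false_theta_recip_coeff_def F_def)
  ultimately show ?thesis
    by (simp add: F_def)
qed

end

theory Submission
  imports Defs "HOL-Library.Z2" "HOL-Number_Theory.Residues"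
begin

text \<open>
  Modulo 2 the signs disappear, so \<open>\<Psi>(-q\<^sup>1\<^sup>3, q)\<close> becomes the theta series
  \<open>T(q) = \<Sum> q\<^bsup>7n\<^sup>2+6n\<^esup>\<close> over all integers \<open>n\<close>. As squaring is \<open>q \<mapsto> q\<^sup>2\<close> modulo 2,
  \<open>1/T(q) = T(q)\<^sup>7/T(q)\<^sup>8 = T(q) T(q\<^sup>2) T(q\<^sup>4) / T(q\<^sup>8)\<close>. In the exponents congruent to 5
  modulo 8, a linear substitution in the triple sum \<open>T(q) T(q\<^sup>2) T(q\<^sup>4)\<close> splits off a factor
  \<open>T(q\<^sup>8)\<close>, which cancels. So \<open>c(8M+5)\<close> has the parity of the number of pairs \<open>(m, b)\<close> with
  \<open>7m\<^sup>2+3m+7b\<^sup>2+2b = M\<close>, that is, \<open>(14m+3)\<^sup>2+(14b+2)\<^sup>2 = 28M+13\<close>. For the progression of the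
  theorem, \<open>28M+13 = p\<^bsup>2k+1\<^esup>(28n+13p)\<close> is divisible by the prime \<open>p \<equiv> 3\<close> modulo 4 to an odd
  power, so it is not a sum of two squares.
\<close>

section \<open>Theta series over the field of two elements\<close>

text \<open>Since \<open>card\<close> of an infinite set is 0, fibre cardinalities multiply
  correctly only under this condition.\<close>

definition finite_fibres :: "('a \<Rightarrow> nat) \<Rightarrow> bool" where
  "finite_fibres w \<longleftrightarrow> (\<forall>m. finite {i. w i = m})"

text \<open>This is the sum of q^(w i) over all indices i, with coefficients modulo 2. Keeping the
  index type free turns a product of such series into one series over pairs.\<close>

definition fibre_series :: "('a \<Rightarrow> nat) \<Rightarrow> bit fps" where
  "fibre_series w = Abs_fps (\<lambda>m. of_nat (card {i. w i = m}))"

lemma fibre_series_mult: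
  assumes "finite_fibres w" "finite_fibres v"
  shows "fibre_series w * fibre_series v = fibre_series (\<lambda>(i, j). w i + v j)"
proof (rule fps_ext)
  fix m
  have "{(i, j). w i + v j = m} = (\<Union>k\<in>{0..m}. {i. w i = k} \<times> {j. v j = m - k})"
    by auto
  then have "card {(i, j). w i + v j = m} = card (\<Union>k\<in>{0..m}. {i. w i = k} \<times> {j. v j = m - k})"
    by simp
  also have "\<dots> = (\<Sum>k=0..m. card ({i. w i = k} \<times> {j. v j = m - k}))"
    by (rule card_UN_disjoint) (use assms in \<open>auto simp: finite_fibres_def\<close>)
  also have "\<dots> = (\<Sum>k=0..m. card {i. w i = k} * card {j. v j = m - k})"
    by (simp add: card_cartesian_product)
  moreover have "{x. (case x of (i, j) \<Rightarrow> w i + v j) = m} = {(i, j). w i + v j = m}"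
    by auto
  ultimately show "fps_nth (fibre_series w * fibre_series v) m
      = fps_nth (fibre_series (\<lambda>(i, j). w i + v j)) m"
    by (simp add: fibre_series_def fps_mult_nth)
qed

lemma finite_fibres_add:
  assumes "finite_fibres w" "finite_fibres v"
  shows "finite_fibres (\<lambda>(i, j). w i + v j)"
  unfolding finite_fibres_def
proof
  fix m
  have "{x. (case x of (i, j) \<Rightarrow> w i + v j) = m} = (\<Union>k\<in>{0..m}. {i. w i = k} \<times> {j. v j = m - k})"
    by auto
  then show "finite {x. (case x of (i, j) \<Rightarrow> w i + v j) = m}"
    using assms by (auto simp: finite_fibres_def)
qed

lemma finite_fibres_dilate:
  assumes "finite_fibres w" "d > 0"
  shows "finite_fibres (\<lambda>i. d * w i)"
  unfolding finite_fibres_def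
proof
  fix m
  have "{i. d * w i = m} \<subseteq> {i. w i = m div d}"
    using \<open>d > 0\<close> by auto
  then show "finite {i. d * w i = m}"
    by (rule finite_subset) (use assms(1) in \<open>simp add: finite_fibres_def\<close>)
qed

lemma fibre_series_dilate_nth:
  assumes "d > 0"
  shows "fps_nth (fibre_series (\<lambda>i. d * w i)) m
    = (if d dvd m then fps_nth (fibre_series w) (m div d) else 0)"
proof (cases "d dvd m")
  case True
  then have "{i. d * w i = m} = {i. w i = m div d}"
    using assms by auto
  with True show ?thesis by (simp add: fibre_series_def)
next
  case False
  then have "{i. d * w i = m} = {}"
    by auto
  with False show ?thesis by (simp add: fibre_series_def)
qed

text \<open>The terms at i and m - i agree and cancel in characteristic 2; only the diagonal term 2i
  = m survives, and b * b = b for bits.\<close>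

lemma bit_fps_square_nth:
  fixes F :: "bit fps"
  shows "fps_nth (F * F) m = (if even m then fps_nth F (m div 2) else 0)"
proof -
  define f where "f i = fps_nth F i * fps_nth F (m - i)" for i
  let ?L = "{i. 2 * i < m}" and ?M = "{i. 2 * i = m}" and ?R = "{i. m < 2 * i \<and> i \<le> m}"
  have fin: "finite ?L" "finite ?M" "finite ?R"
    by (auto intro: finite_subset[of _ "{0..m}"])
  have "{0..m} = (?L \<union> ?R) \<union> ?M"
    by auto
  then have "fps_nth (F * F) m = sum f ((?L \<union> ?R) \<union> ?M)"
    by (simp add: fps_mult_nth f_def)
  also have "\<dots> = sum f (?L \<union> ?R) + sum f ?M"
    by (rule sum.union_disjoint) (use fin in auto)
  also have "sum f (?L \<union> ?R) = sum f ?L + sum f ?R"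
    by (rule sum.union_disjoint) (use fin in auto)
  also have "sum f ?R = sum f ?L"
    by (rule sum.reindex_bij_witness[of _ "\<lambda>i. m - i" "\<lambda>i. m - i"]) (auto simp: f_def mult.commute)
  also have "sum f ?L + sum f ?L = 0"
    by simp
  also have "0 + sum f ?M = (if even m then fps_nth F (m div 2) else 0)"
  proof (cases "even m")
    case True
    then have "?M = {m div 2}" and "m - m div 2 = m div 2"
      by auto
    moreover have "b * b = b" for b :: bit
      by (cases b) auto
    ultimately show ?thesis
      using True by (simp only: f_def sum.insert_if sum.empty finite.emptyI empty_iff if_False if_True add_0_left add_0_right)
  next
    case False
    then have "?M = {}" by auto
    with False show ?thesis by simp
  qed
  finally show ?thesis .
qed

lemma fibre_series_square: "fibre_series w * fibre_series w = fibre_series (\<lambda>i. 2 * w i)"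
  by (rule fps_ext) (simp add: bit_fps_square_nth fibre_series_dilate_nth)

text \<open>Extracting the exponents congruent to r modulo d commutes with multiplication by a
  series in q^d, which turns T(q^8) into T(q) for d = 8.\<close>

lemma section_mult_dilate_nth:
  fixes c :: "bit fps"
  assumes "r < d"
  shows "fps_nth (c * fibre_series (\<lambda>i. d * w i)) (d * m + r)
    = fps_nth (Abs_fps (\<lambda>j. fps_nth c (d * j + r)) * fibre_series w) m"
proof -
  let ?f = "\<lambda>i. fps_nth c i * fps_nth (fibre_series (\<lambda>i. d * w i)) (d * m + r - i)"
  have "d > 0" using assms by simp
  have "fps_nth (c * fibre_series (\<lambda>i. d * w i)) (d * m + r) = sum ?f {0..d * m + r}"
    by (simp add: fps_mult_nth)
  also have "\<dots> = sum ?f ((\<lambda>j. d * j + r) ` {0..m})"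
  proof (rule sum.mono_neutral_right)
    show "(\<lambda>j. d * j + r) ` {0..m} \<subseteq> {0..d * m + r}"
      by auto
    show "\<forall>i\<in>{0..d * m + r} - (\<lambda>j. d * j + r) ` {0..m}. ?f i = 0"
    proof
      fix i assume i: "i \<in> {0..d * m + r} - (\<lambda>j. d * j + r) ` {0..m}"
      have "\<not> d dvd d * m + r - i"
      proof
        assume "d dvd d * m + r - i"
        then obtain l where l: "d * m + r - i = d * l" by (elim dvdE)
        with i have eq: "d * m + r = d * l + i" by auto
        have "l \<le> m"
        proof (rule ccontr)
          assume "\<not> l \<le> m"
          then have "d * (m + 1) \<le> d * l" by (intro mult_le_mono2) simp
          with eq \<open>r < d\<close> show False by (simp add: algebra_simps)
        qed
        with eq have "i = d * (m - l) + r"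
          by (simp add: diff_mult_distrib2)
        with i show False by auto
      qed
      then show "?f i = 0"
        by (simp add: fibre_series_dilate_nth[OF \<open>d > 0\<close>])
    qed
  qed simp
  also have "\<dots> = (\<Sum>j=0..m. ?f (d * j + r))"
    by (subst sum.reindex) (use \<open>d > 0\<close> in \<open>auto simp: inj_on_def\<close>)
  also have "\<dots> = (\<Sum>j=0..m. fps_nth c (d * j + r) * fps_nth (fibre_series w) (m - j))"
    by (rule sum.cong) (use \<open>d > 0\<close> in \<open>auto simp: fibre_series_dilate_nth simp flip: diff_mult_distrib2\<close>)
  finally show ?thesis
    by (simp add: fps_mult_nth)
qed

section \<open>Quadratic exponents and the substitution in the triple sum\<close>

definition quad_weight :: "int \<Rightarrow> int \<Rightarrow> nat" where
  "quad_weight b n = nat (7 * n\<^sup>2 + b * n)"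

text \<open>The bound on b gives 7n^2 + bn >= |n|, so \<open>nat\<close> truncates nothing and every
  value is taken finitely often.\<close>

lemma int_quad_weight:
  assumes "\<bar>b\<bar> \<le> 6"
  shows "int (quad_weight b n) = 7 * n\<^sup>2 + b * n" "\<bar>n\<bar> \<le> int (quad_weight b n)"
proof -
  have "\<bar>n\<bar> \<le> n\<^sup>2"
    using self_le_power[of "\<bar>n\<bar>" 2] by (cases "n = 0") auto
  moreover have "\<bar>b * n\<bar> \<le> 6 * \<bar>n\<bar>"
    unfolding abs_mult using assms by (intro mult_right_mono) auto
  ultimately have "\<bar>n\<bar> \<le> 7 * n\<^sup>2 + b * n"
    by linarith
  then show "int (quad_weight b n) = 7 * n\<^sup>2 + b * n" "\<bar>n\<bar> \<le> int (quad_weight b n)"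
    by (auto simp: quad_weight_def)
qed

lemma finite_fibres_quad_weight:
  assumes "\<bar>b\<bar> \<le> 6"
  shows "finite_fibres (quad_weight b)"
  unfolding finite_fibres_def
proof
  fix m
  have "{n. quad_weight b n = m} \<subseteq> {- int m..int m}"
    using int_quad_weight(2)[OF assms] by (auto simp: abs_le_iff) (smt (verit))
  then show "finite {n. quad_weight b n = m}"
    by (rule finite_subset) simp
qed

text \<open>
  The substitution comes from diagonalising: with \<open>X = 7x+3\<close>, \<open>Y = 7y+3\<close>, \<open>Z = 7z+3\<close> the equation
  says \<open>X\<^sup>2+2Y\<^sup>2+4Z\<^sup>2 = 56M+98\<close>, which forces \<open>X = 2(u+v)\<close> and \<open>Z = u-v\<close>, hence
  \<open>X\<^sup>2+4Z\<^sup>2 = 8(u\<^sup>2+v\<^sup>2)\<close>; here \<open>u = -(7a+3)\<close> and \<open>v = 7b+1\<close>.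
\<close>
lemma quad_triple_parity:
  fixes x y z M :: int
  assumes "7 * x\<^sup>2 + 6 * x + 2 * (7 * y\<^sup>2 + 6 * y) + 4 * (7 * z\<^sup>2 + 6 * z) = 8 * M + 5"
  obtains a b m where "x = 2 * b - 2 * a - 1" "y = 2 * m" "z = - a - b - 1"
proof -
  have "odd x"
  proof
    assume "even x"
    then have "even (7 * x\<^sup>2 + 6 * x + 2 * (7 * y\<^sup>2 + 6 * y) + 4 * (7 * z\<^sup>2 + 6 * z))"
      by simp
    then show False unfolding assms by simp
  qed
  then obtain k where "x = 2 * k + 1"
    by (elim oddE)
  then have "x = 2 * (k + 1) - 1"
    by simp
  then obtain t where t: "x = 2 * t - 1" ..
  \<comment> \<open>Each parity found allows the equation to be halved, and the halved equation
    decides the next parity.\<close>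
  have 1: "14 * t\<^sup>2 - 8 * t + 7 * y\<^sup>2 + 6 * y + 14 * z\<^sup>2 + 12 * z = 4 * M + 2"
    using assms unfolding t by (simp add: power2_eq_square algebra_simps)
  have "even y"
  proof (rule ccontr)
    assume "odd y"
    then have "odd (14 * t\<^sup>2 - 8 * t + 7 * y\<^sup>2 + 6 * y + 14 * z\<^sup>2 + 12 * z)"
      by simp
    then show False unfolding 1 by simp
  qed
  then obtain m where m: "y = 2 * m" ..
  have 2: "7 * t\<^sup>2 - 4 * t + 14 * m\<^sup>2 + 6 * m + 7 * z\<^sup>2 + 6 * z = 2 * M + 1"
    using 1 unfolding m by (simp add: power2_eq_square algebra_simps)
  have "odd (t + z)"
  proof
    assume "even (t + z)"
    then have "even (7 * t\<^sup>2 - 4 * t + 14 * m\<^sup>2 + 6 * m + 7 * z\<^sup>2 + 6 * z)"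
      by auto
    then show False unfolding 2 by simp
  qed
  then obtain s where s: "t + z = 2 * s + 1" by (elim oddE)
  \<comment> \<open>The witnesses solve b - a = t and a + b = -z - 1, which is possible over the
    integers because t + z is odd.\<close>
  show thesis
    by (rule that[where a = "- s - 1" and b = "t - s - 1" and m = m]) (use t m s in auto)
qed

text \<open>The cross terms in ab from x^2 and 4z^2 cancel, so the new variables separate. This is
  the converse of \<open>quad_triple_parity\<close>.\<close>

lemma quad_triple_value:
  fixes a b m :: int
  defines "x \<equiv> 2 * b - 2 * a - 1" and "y \<equiv> 2 * m" and "z \<equiv> - a - b - 1"
  shows "7 * x\<^sup>2 + 6 * x + 2 * (7 * y\<^sup>2 + 6 * y) + 4 * (7 * z\<^sup>2 + 6 * z)
    = 8 * (7 * m\<^sup>2 + 3 * m + (7 * b\<^sup>2 + 2 * b) + (7 * a\<^sup>2 + 6 * a)) + 5"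
proof -
  have "x\<^sup>2 = 4 * b\<^sup>2 + 4 * a\<^sup>2 + 1 - 8 * (a * b) - 4 * b + 4 * a"
    and "y\<^sup>2 = 4 * m\<^sup>2"
    and "z\<^sup>2 = a\<^sup>2 + b\<^sup>2 + 1 + 2 * (a * b) + 2 * a + 2 * b"
    by (simp_all add: x_def y_def z_def power2_eq_square algebra_simps)
  then show ?thesis
    by (simp add: x_def y_def z_def)
qed

text \<open>The substitution is a bijection between the index triples of exponent 8M + 5 on the left
  and those of exponent M on the right; the variable a carries the factor T to be cancelled.\<close>

lemma quad_triple_section:
  "fps_nth (fibre_series (\<lambda>((x, y), z). quad_weight 6 x + 2 * quad_weight 6 y + 4 * quad_weight 6 z))
     (8 * M + 5)
   = fps_nth (fibre_series (\<lambda>((m, b), a). quad_weight 3 m + quad_weight 2 b + quad_weight 6 a)) M"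
proof -
  let ?S = "{((x, y), z). quad_weight 6 x + 2 * quad_weight 6 y + 4 * quad_weight 6 z = 8 * M + 5}"
  let ?T = "{((m, b), a). quad_weight 3 m + quad_weight 2 b + quad_weight 6 a = M}"
  let ?g = "\<lambda>((m, b), a). ((2 * b - 2 * a - 1, 2 * m), - a - b - 1) :: (int \<times> int) \<times> int"
  have S: "((x, y), z) \<in> ?S \<longleftrightarrow>
      7 * x\<^sup>2 + 6 * x + 2 * (7 * y\<^sup>2 + 6 * y) + 4 * (7 * z\<^sup>2 + 6 * z) = 8 * int M + 5" for x y z
  proof -
    have "((x, y), z) \<in> ?S \<longleftrightarrow> int (quad_weight 6 x) + 2 * int (quad_weight 6 y)
        + 4 * int (quad_weight 6 z) = 8 * int M + 5"
      by simp linarith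
    then show ?thesis by (simp add: int_quad_weight(1))
  qed
  have T: "((m, b), a) \<in> ?T \<longleftrightarrow>
      7 * m\<^sup>2 + 3 * m + (7 * b\<^sup>2 + 2 * b) + (7 * a\<^sup>2 + 6 * a) = int M" for m b a
  proof -
    have "((m, b), a) \<in> ?T \<longleftrightarrow> int (quad_weight 3 m) + int (quad_weight 2 b)
        + int (quad_weight 6 a) = int M"
      by simp linarith
    then show ?thesis by (simp add: int_quad_weight(1))
  qed
  have affine: "8 * u + 5 = 8 * v + 5 \<longleftrightarrow> u = v" for u v :: int
    by simp
  have gS: "?g ((m, b), a) \<in> ?S \<longleftrightarrow> ((m, b), a) \<in> ?T" for m b a
    unfolding T prod.case S quad_triple_value by (rule affine)
  have "?S = ?g ` ?T"
  proof (rule Set.set_eqI)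
    fix u :: "(int \<times> int) \<times> int"
    obtain x y z where u: "u = ((x, y), z)" by (metis prod.collapse)
    show "u \<in> ?S \<longleftrightarrow> u \<in> ?g ` ?T"
    proof
      assume *: "u \<in> ?S"
      then obtain a b m where abm: "x = 2 * b - 2 * a - 1" "y = 2 * m" "z = - a - b - 1"
        using quad_triple_parity unfolding u S by metis
      then have u': "u = ?g ((m, b), a)" by (simp add: u)
      with * have "?g ((m, b), a) \<in> ?S" by (simp only:)
      then have "((m, b), a) \<in> ?T" by (rule gS[THEN iffD1])
      with u' show "u \<in> ?g ` ?T" by (rule image_eqI)
    next
      assume "u \<in> ?g ` ?T"
      then obtain v where v: "v \<in> ?T" "u = ?g v" by (rule imageE)
      obtain m b a where mba: "v = ((m, b), a)" by (metis prod.collapse)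
      show "u \<in> ?S" using v(1) unfolding v(2) mba by (rule gS[THEN iffD2])
    qed
  qed
  moreover have "inj_on ?g ?T"
    by (auto simp: inj_on_def)
  ultimately have "card ?S = card ?T"
    by (simp only: card_image)
  then show ?thesis
    by (simp only: fibre_series_def fps_nth_Abs_fps case_prod_beta')
qed

section \<open>Reduction of the false theta function and its reciprocal modulo 2\<close>

lemma of_int_bit_eq_0_iff: "of_int i = (0 :: bit) \<longleftrightarrow> even i"
proof (cases "even i")
  case True
  then show ?thesis by auto
next
  case False
  then obtain j where "i = 2 * j + 1" by (elim oddE)
  then show ?thesis by simp
qed

definition fps_mod2 :: "int fps \<Rightarrow> bit fps" where
  "fps_mod2 F = Abs_fps (\<lambda>m. of_int (fps_nth F m))"

lemma fps_mod2_mult: "fps_mod2 (F * G) = fps_mod2 F * fps_mod2 G"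
  by (rule fps_ext) (simp only: fps_mod2_def fps_nth_Abs_fps fps_mult_nth of_int_sum of_int_mult)

lemma fps_mod2_1: "fps_mod2 1 = 1"
  by (simp add: fps_eq_iff fps_mod2_def)

text \<open>As -1 = 1 modulo 2, both the signs of the terms and the minus between the two half sums
  disappear, leaving one sum over all integers.\<close>

lemma fps_mod2_false_theta:
  assumes "r > 0" "s > 0"
  shows "fps_mod2 (false_theta (- (fps_X ^ r)) (fps_X ^ s))
    = fibre_series (\<lambda>n::int. r * nat (n * (n + 1) div 2) + s * nat (n * (n - 1) div 2))"
proof (rule fps_ext)
  fix m
  define W where "W = (\<lambda>n::int. r * nat (n * (n + 1) div 2) + s * nat (n * (n - 1) div 2))"
  define t where "t n = (- (fps_X ^ r) :: int fps) ^ nat (n * (n + 1) div 2) *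
             (fps_X ^ s) ^ nat (n * (n - 1) div 2)" for n :: int
  have t: "fps_nth (t n) m = (if m = W n then (- 1) ^ nat (n * (n + 1) div 2) else 0)" for n
    unfolding t_def W_def by (rule false_theta_term_nth)
  have supp: "{n. n \<in> A \<and> fps_nth (t n) m \<noteq> 0} = {n \<in> A. W n = m}" for A
    by (auto simp: t)
  have fin: "finite {n \<in> A. W n = m}" for A
    using false_theta_term_finite[OF assms, of A m] supp[of A] by (simp add: t_def)
  have coeff: "of_int (fps_nth (\<Sum>\<^sub>\<infinity>n\<in>A. t n) m) = (of_nat (card {n \<in> A. W n = m}) :: bit)" for A
  proof -
    have "fps_nth (\<Sum>\<^sub>\<infinity>n\<in>A. t n) m = (\<Sum>n | n \<in> A \<and> fps_nth (t n) m \<noteq> 0. fps_nth (t n) m)"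
      unfolding t_def infsumI[OF false_theta_fps_has_sum[OF assms]] fps_nth_Abs_fps ..
    also have "\<dots> = (\<Sum>n | n \<in> A \<and> W n = m. (- 1) ^ nat (n * (n + 1) div 2))"
      unfolding supp by (rule sum.cong) (auto simp: t)
    finally show ?thesis by simp
  qed
  have "of_int (fps_nth (false_theta (- (fps_X ^ r)) (fps_X ^ s)) m)
      = (of_nat (card {n \<in> {0..}. W n = m}) + of_nat (card {n \<in> {..-1}. W n = m}) :: bit)"
    unfolding false_theta_def t_def[symmetric] fps_sub_nth of_int_diff coeff by simp
  also have "\<dots> = of_nat (card ({n \<in> {0..}. W n = m} \<union> {n \<in> {..-1}. W n = m}))"
    by (subst card_Un_disjoint) (use fin[of "{0..}"] fin[of "{..-1}"] in auto)
  also have "{n \<in> {0..}. W n = m} \<union> {n \<in> {..-1}. W n = m} = {n. W n = m}"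
    by auto
  finally show "fps_nth (fps_mod2 (false_theta (- (fps_X ^ r)) (fps_X ^ s))) m
      = fps_nth (fibre_series (\<lambda>n::int. r * nat (n * (n + 1) div 2) + s * nat (n * (n - 1) div 2))) m"
    by (simp add: fps_mod2_def fibre_series_def W_def)
qed

lemma false_theta_13_1_weight:
  "13 * nat (n * (n + 1) div 2) + 1 * nat (n * (n - 1) div 2) = quad_weight 6 n"
proof -
  have "2 * int (nat (n * (n + 1) div 2)) = n * (n + 1)"
    and "2 * int (nat (n * (n - 1) div 2)) = n * (n - 1)"
    unfolding triangular_exponents(1,2) by simp_all
  then have "2 * int (13 * nat (n * (n + 1) div 2) + 1 * nat (n * (n - 1) div 2))
      = 13 * (n * (n + 1)) + n * (n - 1)"
    by simp
  also have "\<dots> = 2 * int (quad_weight 6 n)"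
    by (simp add: int_quad_weight power2_eq_square algebra_simps)
  finally show ?thesis
    by (metis mult_cancel_left of_nat_eq_iff zero_neq_numeral)
qed

lemma recip_coeff_13_1_section:
  "of_int (false_theta_recip_coeff 13 1 (8 * M + 5))
    = (of_nat (card {(m, b). quad_weight 3 m + quad_weight 2 b = M}) :: bit)"
proof -
  define T where "T = fibre_series (quad_weight 6)"
  define C where "C = fps_mod2 (Abs_fps (false_theta_recip_coeff 13 1))"
  define AB where "AB = fibre_series (\<lambda>(m, b). quad_weight 3 m + quad_weight 2 b)"
  define D where "D = Abs_fps (\<lambda>j. fps_nth C (8 * j + 5))"
  have fin: "finite_fibres (quad_weight b)" if "b \<in> {2, 3, 6}" for b
    using that by (intro finite_fibres_quad_weight) auto
  have "C * T = fps_mod2 (Abs_fps (false_theta_recip_coeff 13 1)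
      * false_theta (- (fps_X ^ 13)) (fps_X ^ 1))"
    unfolding C_def T_def fps_mod2_mult
    by (subst fps_mod2_false_theta) (simp_all only: false_theta_13_1_weight zero_less_numeral zero_less_one)
  then have CT: "C * T = 1"
    by (simp only: false_theta_recip_coeff_mult[OF zero_less_numeral zero_less_one] fps_mod2_1)
  have T2: "T * T = fibre_series (\<lambda>i. 2 * quad_weight 6 i)"
    unfolding T_def by (rule fibre_series_square)
  have T4: "(T * T) * (T * T) = fibre_series (\<lambda>i. 4 * quad_weight 6 i)"
    unfolding T2 fibre_series_square by (simp add: mult.assoc[symmetric])
  have T8: "((T * T) * (T * T)) * ((T * T) * (T * T)) = fibre_series (\<lambda>i. 8 * quad_weight 6 i)"
    unfolding T4 fibre_series_square by (simp add: mult.assoc[symmetric])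
  \<comment> \<open>Here T^8 is T(q^8), so multiplying it by C = 1/T leaves T^7, grouped as T * T^2
    * T^4.\<close>
  have "C * fibre_series (\<lambda>i. 8 * quad_weight 6 i) = (C * T) * ((T * (T * T)) * ((T * T) * (T * T)))"
    unfolding T8[symmetric] by (simp only: ac_simps)
  also have "\<dots> = (T * (T * T)) * ((T * T) * (T * T))"
    by (simp add: CT)
  also have "\<dots> = fibre_series
      (\<lambda>((x, y), z). quad_weight 6 x + 2 * quad_weight 6 y + 4 * quad_weight 6 z)"
  proof -
    have fin2: "finite_fibres (\<lambda>i. 2 * quad_weight 6 i)"
      and fin4: "finite_fibres (\<lambda>i. 4 * quad_weight 6 i)"
      by (simp_all add: finite_fibres_dilate fin)
    have fin6: "finite_fibres (quad_weight 6)"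
      by (simp add: fin)
    show ?thesis
      unfolding T4 unfolding T2 unfolding T_def fibre_series_mult[OF fin6 fin2]
        fibre_series_mult[OF finite_fibres_add[OF fin6 fin2] fin4]
      by (simp add: case_prod_beta')
  qed
  finally have CT8: "C * fibre_series (\<lambda>i. 8 * quad_weight 6 i) = \<dots>" .
  have ABT: "AB * T = fibre_series (\<lambda>((m, b), a). quad_weight 3 m + quad_weight 2 b + quad_weight 6 a)"
    unfolding AB_def T_def
    by (subst fibre_series_mult[OF finite_fibres_add[OF fin fin] fin]) (simp_all add: case_prod_beta')
  have "D * T = AB * T"
  proof (rule fps_ext)
    fix j
    have "fps_nth (D * T) j = fps_nth (C * fibre_series (\<lambda>i. 8 * quad_weight 6 i)) (8 * j + 5)"
      unfolding D_def T_def by (subst section_mult_dilate_nth) simp_all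
    then show "fps_nth (D * T) j = fps_nth (AB * T) j"
      by (simp only: CT8 quad_triple_section ABT)
  qed
  \<comment> \<open>Power series over a field form an integral domain, so the nonzero factor T can
    be cancelled.\<close>
  moreover have "T \<noteq> 0"
    using CT by auto
  ultimately have "D = AB"
    by simp
  then have "fps_nth D M = fps_nth AB M"
    by simp
  moreover have "{x. (case x of (m, b) \<Rightarrow> quad_weight 3 m + quad_weight 2 b) = M}
      = {(m, b). quad_weight 3 m + quad_weight 2 b = M}"
    by auto
  ultimately show ?thesis
    by (simp add: D_def AB_def C_def fps_mod2_def fibre_series_def)
qed

section \<open>Sums of two squares and primes congruent to 3 modulo 4\<close>

text \<open>Otherwise p divides neither x nor y. Raising x^2 = -y^2 modulo p to the odd power (p -
  1)/2 and applying Fermat's theorem gives 1 = -1 modulo p, forcing p <= 2.\<close>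

lemma prime_3_mod_4_dvd_sum_squares:
  fixes p x y :: nat
  assumes "prime p" "[p = 3] (mod 4)" "p dvd x\<^sup>2 + y\<^sup>2"
  shows "p dvd x"
proof (rule ccontr)
  assume x: "\<not> p dvd x"
  have y: "\<not> p dvd y"
  proof
    assume "p dvd y"
    then have "p dvd y\<^sup>2" by (simp add: power2_eq_square)
    with assms(3) have "p dvd x\<^sup>2" by (simp add: dvd_add_left_iff)
    with x assms(1) show False using prime_dvd_power by blast
  qed
  have "p mod 4 = 3" using assms(2) by (simp add: cong_def)
  then have "p - 1 = 2 * (2 * (p div 4) + 1)"
    by presburger
  then obtain h where h: "p - 1 = 2 * h" "odd h"
    using that[of "2 * (p div 4) + 1"] by simp
  have "[int x ^ 2 = - (int y ^ 2)] (mod int p)"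
    using assms(3) by (simp add: cong_iff_dvd_diff flip: of_nat_power of_nat_add)
  then have "[(int x ^ 2) ^ h = (- (int y ^ 2)) ^ h] (mod int p)"
    by (rule cong_pow)
  then have "[int (x ^ (p - 1)) = - int (y ^ (p - 1))] (mod int p)"
    using h by (simp add: power_mult)
  moreover have "[int (x ^ (p - 1)) = int 1] (mod int p)" "[int (y ^ (p - 1)) = int 1] (mod int p)"
    using fermat_theorem[OF assms(1)] x y by (simp_all only: cong_int_iff)
  ultimately have "[1 = (- 1 :: int)] (mod int p)"
    by (metis cong_minus_minus_iff cong_sym cong_trans of_nat_1)
  then have "int p dvd 2"
    by (simp add: cong_iff_dvd_diff)
  then have "p \<le> 2"
    using zdvd_imp_le by fastforce
  with \<open>p mod 4 = 3\<close> show False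
    by simp
qed

text \<open>Descent: p divides both x and y, and cancelling p^2 lowers k by one. At k = 0 the
  cancellation would give p dvd t.\<close>

lemma odd_prime_power_not_sum_squares:
  fixes p x y t k :: nat
  assumes "prime p" "[p = 3] (mod 4)" "\<not> p dvd t"
  shows "x\<^sup>2 + y\<^sup>2 \<noteq> p ^ (2 * k + 1) * t"
proof (induction k arbitrary: x y)
  have descent: "\<exists>u v. x = p * u \<and> y = p * v" if "p dvd x\<^sup>2 + y\<^sup>2" for x y
    using prime_3_mod_4_dvd_sum_squares[OF assms(1,2)] that by (metis add.commute dvdE)
  have "p > 0" using assms(1) prime_gt_0_nat by blast
  {
    case 0
    show ?case
    proof
      assume eq: "x\<^sup>2 + y\<^sup>2 = p ^ (2 * 0 + 1) * t"
      then obtain u v where "x = p * u" "y = p * v" using descent by force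
      with eq have "p * (p * (u\<^sup>2 + v\<^sup>2)) = p * t"
        by (simp add: power2_eq_square algebra_simps)
      with \<open>p > 0\<close> assms(3) show False by auto
    qed
  next
    case (Suc k)
    show ?case
    proof
      assume eq: "x\<^sup>2 + y\<^sup>2 = p ^ (2 * Suc k + 1) * t"
      then obtain u v where "x = p * u" "y = p * v" using descent[of x y] by auto
      with eq have "p * p * (u\<^sup>2 + v\<^sup>2) = p * p * (p ^ (2 * k + 1) * t)"
        by (simp add: power2_eq_square algebra_simps)
      with \<open>p > 0\<close> Suc.IH show False by auto
    qed
  }
qed

section \<open>The arithmetic progression\<close>

theorem theorem4p3:
  fixes p n k :: nat
  assumes "prime p"
    and "[p = 15] (mod 28) \<or> [p = 27] (mod 28)"
    and "\<not> p dvd n"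
  shows "[false_theta_recip_coeff 13 1
            (8 * p ^ (2 * k + 1) * n + (26 * p ^ (2 * k + 2) + 9) div 7) = 0] (mod 2)"
proof -
  have p28: "p mod 28 = 15 \<or> p mod 28 = 27"
    using assms(2) by (simp add: cong_def)
  have p4: "[p = 3] (mod 4)"
  proof -
    have "p mod 4 = p mod 28 mod 4"
      by (simp add: mod_mod_cancel)
    with p28 show ?thesis by (auto simp: cong_def)
  qed
  \<comment> \<open>Modulus 56 makes the division by 7 exact and yields residue 5 modulo 8: 26(56q +
    1) + 9 = 7(8 * 26q + 5).\<close>
  have "p\<^sup>2 mod 56 = 1"
  proof -
    obtain d where "p = 28 * d + 15 \<or> p = 28 * d + 27"
      using p28 by (metis mult_div_mod_eq)
    then have "p\<^sup>2 = 56 * (14 * d\<^sup>2 + 15 * d + 4) + 1 \<or> p\<^sup>2 = 56 * (14 * d\<^sup>2 + 27 * d + 13) + 1"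
      by (auto simp: power2_eq_square algebra_simps)
    then show ?thesis
      by (metis mod_mult_self4 mod_less one_less_numeral_iff semiring_norm(76))
  qed
  then have "[p\<^sup>2 = 1] (mod 56)" by (simp add: cong_def)
  then have "[(p\<^sup>2) ^ (k + 1) = 1 ^ (k + 1)] (mod 56)" by (rule cong_pow)
  moreover have "(p\<^sup>2) ^ (k + 1) = p ^ (2 * k + 2)"
    by (simp only: power_mult[symmetric]) simp
  ultimately have "p ^ (2 * k + 2) mod 56 = 1"
    by (simp only: cong_def power_one) simp
  then obtain q where q: "p ^ (2 * k + 2) = 56 * q + 1"
    by (metis mult.commute div_mult_mod_eq)
  define M where "M = p ^ (2 * k + 1) * n + 26 * q"
  have "8 * p ^ (2 * k + 1) * n + (26 * p ^ (2 * k + 2) + 9) div 7 = 8 * M + 5"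
    unfolding q M_def by simp
  moreover have "{(m, b). quad_weight 3 m + quad_weight 2 b = M} = {}"
  proof -
    have "quad_weight 3 m + quad_weight 2 b \<noteq> M" for m b
    proof
      assume "quad_weight 3 m + quad_weight 2 b = M"
      then have "int M = 7 * m\<^sup>2 + 3 * m + (7 * b\<^sup>2 + 2 * b)"
        by (auto simp: int_quad_weight)
      \<comment> \<open>Multiplying by 28 completes both squares, with 13 = 3^2 + 2^2.\<close>
      then have "28 * int M + 13 = (14 * m + 3)\<^sup>2 + (14 * b + 2)\<^sup>2"
        by (simp add: power2_eq_square algebra_simps)
      then have "int ((nat \<bar>14 * m + 3\<bar>)\<^sup>2 + (nat \<bar>14 * b + 2\<bar>)\<^sup>2) = int (28 * M + 13)"
        by simp
      then have "(nat \<bar>14 * m + 3\<bar>)\<^sup>2 + (nat \<bar>14 * b + 2\<bar>)\<^sup>2 = 28 * M + 13"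
        by (simp only: of_nat_eq_iff)
      \<comment> \<open>The powers of p recombine because 28 * 26 = 13 * 56, so 28 * 26q + 13 =
        13(56q + 1).\<close>
      also have "28 * M + 13 = 28 * p ^ (2 * k + 1) * n + 13 * p ^ (2 * k + 2)"
        unfolding q M_def by simp
      also have "\<dots> = p ^ (2 * k + 1) * (28 * n + 13 * p)"
        by (simp add: algebra_simps)
      finally have "(nat \<bar>14 * m + 3\<bar>)\<^sup>2 + (nat \<bar>14 * b + 2\<bar>)\<^sup>2 = p ^ (2 * k + 1) * (28 * n + 13 * p)" .
      moreover have "\<not> p dvd 28 * n + 13 * p"
      proof
        assume "p dvd 28 * n + 13 * p"
        then have "p dvd 28 * n" by (simp add: dvd_add_left_iff)
        moreover have "\<not> p dvd 28"
        proof
          assume d: "p dvd 28"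
          then have "p \<le> 28" by (rule dvd_imp_le) simp
          with p28 have "p = 15 \<or> p = 27" by (cases "p = 28") auto
          with d show False by auto
        qed
        ultimately show False using assms(1,3) prime_dvd_mult_iff by blast
      qed
      ultimately show False
        using odd_prime_power_not_sum_squares[OF assms(1) p4] by blast
    qed
    then show ?thesis by auto
  qed
  ultimately have "of_int (false_theta_recip_coeff 13 1
      (8 * p ^ (2 * k + 1) * n + (26 * p ^ (2 * k + 2) + 9) div 7)) = (0 :: bit)"
    by (simp only: recip_coeff_13_1_section) simp
  then show ?thesis
    by (simp add: of_int_bit_eq_0_iff cong_0_iff)
qed

end
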